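(* Let $b>1$ and let $(X_n)_{n\ge1}$ be a sequence of positive random variables (with no assumption on their dependence or stationarity). Set $Y_n=\prod_{k=1}^{n}X_k$ and, for each integer $h$ and each $N\ge1$, $$T_N^{(h)}=\frac1N\sum_{n=1}^{N}e_h\Big(\sum_{k=1}^{n}\log_b X_k\Big).$$ Suppose that for every integer $h\neq0$ there exists some $p\ge1$ such that $\sum_{N=1}^{\infty}\frac{\mathbb{E}|T_N^{(h)}|^p}{N}<+\infty$. Then $(Y_n)$ is almost surely Benford in base $b$.
   Context: All random variables are defined on one probability space $(\Omega,\mathcal{T},P)$. $e_h(x)=\exp(2i\pi h x)$ for real $x$ and integer $h$; $\log_b$ is the logarithm in base $b$. The mantissa in base $b$ of $x>0$ is the unique $\mathcal{M}_b(x)\in[1,b[$ such that $x=\mathcal{M}_b(x)b^k$ for some integer $k$. A sequence $(u_n)$ of positive numbers is Benford in base $b$ if $\lim_{N\to+\infty}\frac1N\sum_{n=1}^N \mathbf{1}_{[1,a[}(\mathcal{M}_b(u_n))=\log_b a$ for all $1\le a<b$. A sequence $(Z_n)$ of positive random variables is almost surely Benford in base $b$ if $P(\{\omega : (Z_n(\omega)) \text{ is a Benford sequence in base } b\})=1$. *)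

theory Defs
  imports "HOL-Probability.Probability"
begin

text \<open>Sequences are indexed by the integers \<open>n \<ge> 1\<close>; the value at index \<open>0\<close> is never used.\<close>

definition e_char :: "int \<Rightarrow> real \<Rightarrow> complex" where
  "e_char h x = exp (2 * \<i> * of_real pi * of_int h * of_real x)"

text \<open>Meaningful for \<open>b > 1\<close> and \<open>x > 0\<close>, where the described number exists and is unique.\<close>

definition mantissa_base :: "real \<Rightarrow> real \<Rightarrow> real" where
  "mantissa_base b x = (THE m. 1 \<le> m \<and> m < b \<and> (\<exists>k::int. x = m * b powi k))"

definition benford :: "real \<Rightarrow> (nat \<Rightarrow> real) \<Rightarrow> bool" where
  "benford b u \<longleftrightarrow>
     (\<forall>n\<ge>1. u n > 0) \<and>
     (\<forall>a. 1 \<le> a \<and> a < b \<longrightarrow>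
        (\<lambda>N. (1 / real N) * (\<Sum>n=1..N. indicator {1..<a} (mantissa_base b (u n))))
          \<longlonglongrightarrow> log b a)"

text \<open>Since \<^const>\<open>measure\<close> is \<open>0\<close> on non-measurable sets, this includes measurability
  of the event.\<close>

definition almost_surely_benford :: "'a measure \<Rightarrow> real \<Rightarrow> (nat \<Rightarrow> 'a \<Rightarrow> real) \<Rightarrow> bool" where
  "almost_surely_benford M b Z \<longleftrightarrow>
     measure M {\<omega> \<in> space M. benford b (\<lambda>n. Z n \<omega>)} = 1"

definition exp_mean :: "real \<Rightarrow> (nat \<Rightarrow> 'a \<Rightarrow> real) \<Rightarrow> int \<Rightarrow> nat \<Rightarrow> 'a \<Rightarrow> complex" where
  "exp_mean b X h N \<omega> =
     (1 / of_nat N) * (\<Sum>n=1..N. e_char h (\<Sum>k=1..n. log b (X k \<omega>)))"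

end

theory Submission
  imports Defs
begin

text \<open>
  Put \<open>S\<^sub>n = log b X\<^sub>1 + \<dots> + log b X\<^sub>n = log b Y\<^sub>n\<close>. The mantissa of \<open>Y\<^sub>n\<close> is
  \<open>b powr frac S\<^sub>n\<close>, so \<open>(Y\<^sub>n)\<close> is Benford as soon as \<open>(S\<^sub>n)\<close> is equidistributed modulo 1. By
  Weyl's criterion that follows once the means \<open>T\<^sub>N\<close> of \<open>e_char h S\<^sub>n\<close> tend to \<open>0\<close> for every
  \<open>h \<noteq> 0\<close>. There are countably many \<open>h\<close>, so each may be treated separately and
  with its own exponent \<open>p\<close>.

  For fixed \<open>h\<close>, exchanging sum and expectation turns the moment hypothesis into the almost sure
  convergence of \<open>\<Sum>N. norm T\<^sub>N powr p / N\<close>. This convergence alone would not force a sequence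
  to tend to \<open>0\<close>, but \<open>T\<^sub>N\<close> is a mean of numbers of modulus 1 and hence varies slowly: if
  \<open>norm T\<^sub>N \<ge> \<epsilon>\<close>, then \<open>norm T\<^sub>n \<ge> \<epsilon> / 2\<close> on a whole block \<open>N \<le> n \<le> (1 + d) N\<close> with \<open>d\<close>
  proportional to \<open>\<epsilon>\<close>. Such a block contributes to the series an amount bounded below
  independently of \<open>N\<close>, so by the Cauchy criterion only finitely many \<open>N\<close> are possible
  (\<open>avg_tendsto_0_if_summable\<close>).

  Weyl's criterion (\<open>weyl_criterion\<close>) is obtained by the Stone--Weierstrass theorem on the unit
  circle: real polynomials restricted to the circle are trigonometric polynomials, so the means of
  every continuous function on the circle converge to its integral. Letting continuous
  functions decrease to the indicator of a closed arc bounds the upper frequency of visits to that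
  arc by its length. Applied to an arc and to its complement, the upper bound alone gives
  the limit.

  The probability of a non-measurable event is \<open>0\<close> by convention, so the event of being Benford also
  has to be shown measurable. The distribution functions
  involved are monotone and their limit is continuous, so it is enough to test the Benford
  condition at rational \<open>a\<close>.
\<close>

section \<open>Slowly varying means\<close>

definition avg :: "(nat \<Rightarrow> 'a::real_normed_vector) \<Rightarrow> nat \<Rightarrow> 'a" where
  "avg s N = (1 / real N) *\<^sub>R (\<Sum>n=1..N. s n)"

lemma avg_add: "avg (\<lambda>n. s n + t n) N = avg s N + avg t N"
  by (simp add: avg_def sum.distrib scaleR_add_right)

lemma avg_diff: "avg (\<lambda>n. s n - t n) N = avg s N - avg t N"
  by (simp add: avg_def sum_subtractf scaleR_diff_right)

lemma avg_mult_left: "avg (\<lambda>n. c * s n) N = c * avg s N"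
  for s :: "nat \<Rightarrow> 'a::real_normed_algebra"
  by (simp add: avg_def sum_distrib_left)

lemma avg_of_real: "avg (\<lambda>n. of_real (s n) :: 'a::real_normed_algebra_1) N = of_real (avg s N)"
  by (simp add: avg_def scaleR_conv_of_real flip: of_real_sum of_real_mult)

lemma avg_const: "N \<ge> 1 \<Longrightarrow> avg (\<lambda>n. c) N = c"
  by (simp add: avg_def sum_constant_scaleR)

lemma avg_mono: "(\<And>n. s n \<le> t n) \<Longrightarrow> avg s N \<le> avg t N"
  for s t :: "nat \<Rightarrow> real"
  unfolding avg_def by (intro scaleR_left_mono sum_mono) auto

lemma norm_avg_le:
  assumes "\<And>n. norm (s n) \<le> e"
  shows "norm (avg s N) \<le> e"
proof (cases "N = 0")
  case True
  have "0 \<le> e"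
    using assms[of 0] norm_ge_zero order_trans by blast
  with True show ?thesis by (simp add: avg_def)
next
  case False
  have "norm (\<Sum>n=1..N. s n) \<le> real (card {1..N}) * e"
    by (rule order_trans[OF norm_sum sum_bounded_above]) (use assms in auto)
  then show ?thesis
    using False by (simp add: avg_def field_simps)
qed

text \<open>Slow variation: \<open>real N * norm (avg s N)\<close> is the norm of a partial sum, and each further term
  changes that norm by at most 1.\<close>

lemma norm_avg_ge:
  assumes s: "\<And>n. norm (s n) \<le> 1" and "N \<le> n"
  shows "real N * norm (avg s N) - (real n - real N) \<le> real n * norm (avg s n)"
proof -
  have scaled: "real m * norm (avg s m) = norm (\<Sum>k=1..m. s k)" for m
    by (cases "m = 0") (simp_all add: avg_def)
  have "(\<Sum>k=1..n. s k) = (\<Sum>k=1..N. s k) + (\<Sum>k=N+1..n. s k)"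
    using \<open>N \<le> n\<close> by (metis sum.ub_add_nat le_add_diff_inverse le_add2)
  moreover have "norm (\<Sum>k=N+1..n. s k) \<le> real (card {N+1..n}) * 1"
    by (rule order_trans[OF norm_sum sum_bounded_above]) (use s in auto)
  moreover have "real (card {N+1..n}) = real n - real N"
    using \<open>N \<le> n\<close> by simp
  ultimately show ?thesis
    using norm_triangle_ineq4[of "(\<Sum>k=1..n. s k)" "\<Sum>k=N+1..n. s k"]
    by (simp add: scaled)
qed

text \<open>If the mean has norm at least \<open>\<epsilon>\<close> at \<open>N\<close>, slow variation keeps it at least \<open>\<epsilon> / 2\<close> up to
  \<open>N + L\<close>, where \<open>L\<close> is the integer part of \<open>N * d\<close> and \<open>d = \<epsilon> / 4\<close>. Over this block the sum of \<open>1 / n\<close>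
  is at least \<open>d / (1 + d)\<close>, whatever \<open>N\<close> is. So large means at arbitrarily large \<open>N\<close>
  contradict the Cauchy criterion for the series.\<close>

lemma avg_tendsto_0_if_summable:
  assumes s: "\<And>n. norm (s n) \<le> 1" and p: "p > 0"
    and summ: "summable (\<lambda>N. norm (avg s N) powr p / real N)"
  shows "avg s \<longlonglongrightarrow> 0"
proof (rule ccontr)
  assume "\<not> avg s \<longlonglongrightarrow> 0"
  then obtain \<epsilon> where \<epsilon>: "\<epsilon> > 0" and often: "\<And>N0. \<exists>N\<ge>N0. norm (avg s N) \<ge> \<epsilon>"
    unfolding LIMSEQ_iff by (auto simp: not_less)
  define d where "d = \<epsilon> / 4"
  \<comment> \<open>the amount that each block adds to the series, at the least\<close>
  define c where "c = (\<epsilon> / 2) powr p * d / (1 + d)"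
  have d: "d > 0" and c: "c > 0"
    using \<epsilon> by (simp_all add: d_def c_def add_pos_pos)
  obtain N0 where N0: "\<And>m n. m \<ge> N0 \<Longrightarrow>
      norm (\<Sum>N=m..<n. norm (avg s N) powr p / real N) < c"
    using summ c unfolding summable_Cauchy by blast
  obtain N where N: "N \<ge> max N0 1" "norm (avg s N) \<ge> \<epsilon>"
    using often by blast
  have "norm (avg s N) \<le> 1"
    using s by (rule norm_avg_le)
  with N have \<epsilon>1: "\<epsilon> \<le> 1" by linarith
  define L where "L = nat \<lfloor>real N * d\<rfloor>"
  have L: "real L \<le> real N * d" "real N * d \<le> real L + 1"
    using d by (simp_all add: L_def)
  have lower: "(\<epsilon> / 2) powr p / (real N * (1 + d)) \<le> norm (avg s n) powr p / real n"
    if n: "n \<in> {N..<N+L+1}" for n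
  proof -
    have "real n \<le> real (N + L)" using n by (intro of_nat_mono) simp
    then have n_le: "real n \<le> real N * (1 + d)" and "real n - real N \<le> real N * d"
      using L(1) by (simp_all add: distrib_left)
    have npos: "real n > 0" using n N by simp
    have "real n * (\<epsilon> / 2) \<le> real N * (1 + d) * (\<epsilon> / 2)"
      using n_le \<epsilon> by (intro mult_right_mono) auto
    also have "\<dots> = real N * ((1 + d) * (\<epsilon> / 2))" by simp
    also have "\<dots> \<le> real N * (\<epsilon> - d)"
    proof (rule mult_left_mono)
      have "\<epsilon> * \<epsilon> \<le> \<epsilon> * 1" using \<epsilon> \<epsilon>1 by (intro mult_left_mono) auto
      then show "(1 + d) * (\<epsilon> / 2) \<le> \<epsilon> - d"
        using \<epsilon> unfolding d_def by (simp add: algebra_simps)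
    qed simp
    also have "\<dots> \<le> real N * norm (avg s N) - (real n - real N)"
      using mult_left_mono[OF N(2), of "real N"] \<open>real n - real N \<le> real N * d\<close>
      by (simp add: right_diff_distrib)
    also have "\<dots> \<le> real n * norm (avg s n)"
      by (rule norm_avg_ge[OF s]) (use n in auto)
    finally have "\<epsilon> / 2 \<le> norm (avg s n)"
      using npos by simp
    then show ?thesis
      using \<epsilon> p npos n_le by (intro frac_le powr_mono2) auto
  qed
  have "c = real N * d * ((\<epsilon> / 2) powr p / (real N * (1 + d)))"
    using N by (simp add: c_def)
  also have "\<dots> \<le> real (card {N..<N+L+1}) * ((\<epsilon> / 2) powr p / (real N * (1 + d)))"
    using L(2) d by (intro mult_right_mono) auto
  also have "\<dots> \<le> (\<Sum>n\<in>{N..<N+L+1}. norm (avg s n) powr p / real n)"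
    by (rule sum_bounded_below) (rule lower)
  also have "\<dots> < c"
    using N0[of N "N+L+1"] N(1) by (simp add: abs_less_iff)
  finally show False by simp
qed

section \<open>Weyl's equidistribution criterion\<close>

text \<open>An inductive definition keeps trigonometric polynomials free of coefficient sequences:
  closure under products, and each linear property below, follows by rule induction.\<close>

inductive trig_poly :: "(real \<Rightarrow> complex) \<Rightarrow> bool" where
  monomial: "trig_poly (\<lambda>x. c * e_char h x)"
| add: "trig_poly f \<Longrightarrow> trig_poly g \<Longrightarrow> trig_poly (\<lambda>x. f x + g x)"

lemma e_char_eq_cis: "e_char h x = cis (2 * pi * of_int h * x)"
  by (simp add: e_char_def cis_conv_exp mult_ac)

lemma e_char_add_left: "e_char (h + k) x = e_char h x * e_char k x"
  by (simp add: e_char_eq_cis cis_mult ring_distribs)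

lemma e_char_0: "e_char 0 x = 1"
  by (simp add: e_char_eq_cis)

lemma trig_poly_const: "trig_poly (\<lambda>x. c)"
  using monomial[of c 0] by (simp add: e_char_0)

lemma trig_poly_mult_monomial:
  "trig_poly f \<Longrightarrow> trig_poly (\<lambda>x. f x * (c * e_char h x))"
proof (induction rule: trig_poly.induct)
  case (monomial d k)
  have "trig_poly (\<lambda>x. (d * c) * e_char (k + h) x)"
    by (rule trig_poly.monomial)
  then show ?case by (simp add: e_char_add_left mult_ac)
next
  case (add f g)
  then show ?case by (simp add: distrib_right trig_poly.add)
qed

lemma trig_poly_mult:
  assumes "trig_poly g" "trig_poly f"
  shows "trig_poly (\<lambda>x. f x * g x)"
  using assms
  by (induction rule: trig_poly.induct)
    (simp_all add: trig_poly_mult_monomial distrib_left trig_poly.add)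

text \<open>On the unit circle \<open>cnj z = inverse z\<close>, so a real-linear function, being a combination of \<open>z\<close> and
  \<open>cnj z\<close>, becomes a combination of \<open>e_char 1\<close> and \<open>e_char (-1)\<close>. Sums and products
  stay within the class.\<close>

lemma trig_poly_real_polynomial:
  assumes "real_polynomial_function p"
  shows "trig_poly (\<lambda>x. of_real (p (cis (2 * pi * x))))"
  using assms
proof induction
  case (linear f)
  then interpret f: bounded_linear f .
  define c where "c = (f 1 - \<i> * f \<i>) / 2"
  define d where "d = (f 1 + \<i> * f \<i>) / 2"
  have decompose: "complex_of_real (f z) = c * z + d * cnj z" for z
  proof -
    have "z = Re z *\<^sub>R 1 + Im z *\<^sub>R \<i>"
      by (simp add: complex_eq_iff)
    then have "f z = f (Re z *\<^sub>R 1 + Im z *\<^sub>R \<i>)" by simp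
    also have "\<dots> = Re z * f 1 + Im z * f \<i>"
      by (simp add: f.add f.scaleR)
    finally show ?thesis by (simp add: c_def d_def complex_eq_iff field_simps)
  qed
  have "trig_poly (\<lambda>x. c * e_char 1 x + d * e_char (-1) x)"
    by (intro trig_poly.add trig_poly.monomial)
  then show ?case
    by (simp add: decompose e_char_eq_cis cis_cnj)
qed (simp_all add: trig_poly_const trig_poly.add trig_poly_mult)

lemma e_char_has_integral:
  assumes "h \<noteq> 0"
  shows "(e_char h has_integral 0) {0..1}"
proof -
  define a where "a = 2 * \<i> * of_real pi * complex_of_int h"
  have "(e_char h has_integral (e_char h 1 / a - e_char h 0 / a)) {0..1}"
  proof (rule fundamental_theorem_of_calculus)
    fix x :: real
    have "((\<lambda>z. exp (a * z) / a) has_field_derivative exp (a * of_real x)) (at (of_real x))"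
      using assms by (auto intro!: derivative_eq_intros simp: a_def)
    from has_vector_derivative_real_field[OF this]
    show "((\<lambda>x. e_char h x / a) has_vector_derivative e_char h x) (at x within {0..1})"
      by (simp add: e_char_def a_def)
  qed simp
  then show ?thesis by (simp add: e_char_eq_cis)
qed

text \<open>Both sides are linear in \<open>f\<close>, so monomials suffice. For \<open>h \<noteq> 0\<close> the limit and the
  integral are both \<open>0\<close>; for \<open>h = 0\<close> both are the constant.\<close>

lemma trig_poly_equidistributed:
  assumes x: "\<And>h. h \<noteq> 0 \<Longrightarrow> avg (\<lambda>n. e_char h (x n)) \<longlonglongrightarrow> 0"
    and "trig_poly f"
  shows "f integrable_on {0..1} \<and> avg (\<lambda>n. f (x n)) \<longlonglongrightarrow> integral {0..1} f"
  using assms(2)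
proof induction
  case (monomial c h)
  show ?case
  proof (cases "h = 0")
    case True
    have "eventually (\<lambda>N. c = avg (\<lambda>n. c) N) sequentially"
      using eventually_ge_at_top[of 1] by eventually_elim (simp add: avg_const)
    then have "avg (\<lambda>n. c) \<longlonglongrightarrow> c"
      by (rule Lim_transform_eventually[OF tendsto_const])
    with True show ?thesis by (simp add: e_char_0 integrable_const_ivl)
  next
    case False
    have "((\<lambda>t. c * e_char h t) has_integral c * 0) {0..1}"
      by (intro has_integral_mult_right e_char_has_integral False)
    moreover have "avg (\<lambda>n. c * e_char h (x n)) \<longlonglongrightarrow> c * 0"
      unfolding avg_mult_left[abs_def] by (intro tendsto_intros x False)
    ultimately show ?thesis
      by (metis has_integral_integrable integral_unique mult_zero_right)
  qed
next
  case (add f g)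
  then show ?case
    by (auto simp: avg_add[abs_def] integral_add intro!: integrable_add tendsto_add)
qed

lemma circle_continuous_integrable:
  assumes g: "continuous_on (sphere 0 1) (g :: complex \<Rightarrow> real)"
  shows "(\<lambda>t. g (cis (2 * pi * t))) integrable_on {0..1}"
  by (intro integrable_continuous_real continuous_on_compose2[OF g]) (auto intro!: continuous_intros)

text \<open>A function on the circle is within \<open>e\<close> of a trigonometric polynomial, uniformly, by
  Stone--Weierstrass. Neither its means nor its integral move by more than \<open>e\<close> under this
  replacement.\<close>

lemma continuous_equidistributed:
  assumes x: "\<And>h. h \<noteq> 0 \<Longrightarrow> avg (\<lambda>n. e_char h (x n)) \<longlonglongrightarrow> 0"
    and g: "continuous_on (sphere 0 1) (g :: complex \<Rightarrow> real)"
  shows "avg (\<lambda>n. g (cis (2 * pi * x n))) \<longlonglongrightarrow> integral {0..1} (\<lambda>t. g (cis (2 * pi * t)))"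
proof (rule LIMSEQ_I)
  fix r :: real assume "r > 0"
  define e where "e = r / 3"
  have e: "e > 0" using \<open>r > 0\<close> by (simp add: e_def)
  obtain p where p: "real_polynomial_function p" "\<And>z. z \<in> sphere 0 1 \<Longrightarrow> \<bar>g z - p z\<bar> < e"
    using Stone_Weierstrass_real_polynomial_function[OF compact_sphere g e] by blast
  define P where "P t = p (cis (2 * pi * t))" for t
  define G where "G t = g (cis (2 * pi * t))" for t
  have close: "\<bar>G t - P t\<bar> \<le> e" for t
    using p(2)[of "cis (2 * pi * t)"] by (simp add: G_def P_def)
  have cont: "continuous_on (sphere 0 1) p"
    using p(1) by (simp add: continuous_on_polymonial_function real_polynomial_function_eq)
  have Pint: "P integrable_on {0..1}"
    unfolding P_def by (rule circle_continuous_integrable[OF cont])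
  have Gint: "G integrable_on {0..1}"
    unfolding G_def by (rule circle_continuous_integrable[OF g])
  have "trig_poly (\<lambda>t. of_real (P t))"
    unfolding P_def using p(1) by (rule trig_poly_real_polynomial)
  then have "avg (\<lambda>n. complex_of_real (P (x n))) \<longlonglongrightarrow> integral {0..1} (\<lambda>t. complex_of_real (P t))"
    using trig_poly_equidistributed[OF x] by blast
  moreover have "integral {0..1} (\<lambda>t. complex_of_real (P t)) = of_real (integral {0..1} P)"
    by (intro integral_unique has_integral_of_real integrable_integral Pint)
  ultimately have "(\<lambda>N. complex_of_real (avg (\<lambda>n. P (x n)) N)) \<longlonglongrightarrow> of_real (integral {0..1} P)"
    by (simp add: avg_of_real[abs_def])
  then have "avg (\<lambda>n. P (x n)) \<longlonglongrightarrow> integral {0..1} P"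
    by (simp add: tendsto_of_real_iff)
  then obtain N0 where N0: "\<And>N. N \<ge> N0 \<Longrightarrow> \<bar>avg (\<lambda>n. P (x n)) N - integral {0..1} P\<bar> < e"
    using LIMSEQ_D[OF _ e] by (metis real_norm_def)
  have "norm (integral {0..1} (\<lambda>t. G t - P t)) \<le> integral {0..1} (\<lambda>t::real. e)"
    by (rule integral_norm_bound_integral) (use close in \<open>auto intro: integrable_diff Gint Pint\<close>)
  then have I: "\<bar>integral {0..1} G - integral {0..1} P\<bar> \<le> e"
    by (simp add: integral_diff[OF Gint Pint])
  have "norm (avg (\<lambda>n. G (x n)) N - integral {0..1} G) < r" if "N \<ge> N0" for N
  proof -
    have "norm (avg (\<lambda>n. G (x n)) N - avg (\<lambda>n. P (x n)) N) \<le> e"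
      unfolding avg_diff[symmetric] by (rule norm_avg_le) (simp add: close)
    with N0[OF that] I show ?thesis
      unfolding e_def real_norm_def by linarith
  qed
  then show "\<exists>no. \<forall>n\<ge>no. norm (avg (\<lambda>n. g (cis (2 * pi * x n))) n -
      integral {0..1} (\<lambda>t. g (cis (2 * pi * t)))) < r"
    unfolding G_def by blast
qed

lemma cis_2pi_eq_imp_eq:
  assumes eq: "cis (2 * pi * s) = cis (2 * pi * t)" and "0 < s" "s < 1" "0 \<le> t" "t \<le> 1"
  shows "s = t"
proof -
  from eq obtain n :: int where "\<i> * of_real (2 * pi * s) = \<i> * of_real (2 * pi * t) + of_int (2 * n) * pi * \<i>"
    unfolding cis_conv_exp exp_eq by auto
  then have "2 * pi * s = 2 * pi * t + 2 * pi * of_int n"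
    by (simp add: complex_eq_iff mult_ac)
  then have "2 * pi * s = 2 * pi * (t + of_int n)"
    by (simp add: ring_distribs)
  then have s: "s = t + of_int n" by simp
  then have "real_of_int n > -1" "real_of_int n < 1" using assms by linarith+
  then have "n = 0" by linarith
  with s show ?thesis by simp
qed

lemma cis_2pi_frac: "cis (2 * pi * frac x) = cis (2 * pi * x)"
  by (simp add: frac_def right_diff_distrib flip: cis_divide)

text \<open>The functions \<open>g k\<close>, equal to 1 on the arc and falling to 0 within distance \<open>1 / k\<close> of it, are
  continuous, lie above the indicator of the closed arc and converge to it pointwise. Their
  integrals therefore tend to the length \<open>b - a\<close>, and for a suitable \<open>k\<close> the means of \<open>g k\<close> are eventually
  below \<open>y\<close>. Measuring distance in the plane takes care of the identification of \<open>0\<close> and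
  \<open>1\<close>.\<close>

lemma closed_arc_frequency_upper_bound:
  assumes x: "\<And>h. h \<noteq> 0 \<Longrightarrow> avg (\<lambda>n. e_char h (x n)) \<longlonglongrightarrow> 0"
    and ab: "0 \<le> a" "a \<le> b" "b \<le> 1" and y: "b - a < y"
  shows "eventually (\<lambda>N. avg (\<lambda>n. indicator {a..b} (frac (x n))) N < y) sequentially"
proof -
  define K where "K = (\<lambda>t. cis (2 * pi * t)) ` {a..b}"
  have "compact K"
    unfolding K_def by (intro compact_continuous_image) (auto intro!: continuous_intros)
  then have K: "closed K" "K \<noteq> {}"
    using ab by (auto simp: K_def compact_imp_closed)
  define g where "g k z = max 0 (1 - real k * infdist z K)" for k z
  have cont: "continuous_on (sphere 0 1) (g k)" for k
    unfolding g_def by (intro continuous_intros)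
  have g1: "g k z = 1" if "z \<in> K" for k z
    using that by (simp add: g_def)
  have g_lim: "(\<lambda>k. g k z) \<longlonglongrightarrow> indicator K z" for z
  proof (cases "z \<in> K")
    case True
    then show ?thesis by (simp add: g1)
  next
    case False
    then have d: "infdist z K > 0" by (intro infdist_pos_not_in_closed K)
    obtain k0 where k0: "1 < real k0 * infdist z K"
      using reals_Archimedean3[OF d] by blast
    have "g k z = 0" if "k \<ge> k0" for k
    proof -
      have "real k0 * infdist z K \<le> real k * infdist z K"
        using that d by (intro mult_right_mono) auto
      with k0 show ?thesis by (simp add: g_def)
    qed
    then have "eventually (\<lambda>k. 0 = g k z) sequentially"
      unfolding eventually_sequentially by metis
    then show ?thesis
      using False by (auto intro: Lim_transform_eventually[OF tendsto_const])
  qed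
  have "(\<lambda>k. integral {0..1} (\<lambda>t. g k (cis (2 * pi * t)))) \<longlonglongrightarrow>
      integral {0..1} (\<lambda>t. indicator K (cis (2 * pi * t)))"
  proof (rule dominated_convergence(2)[where h = "\<lambda>_. 1"])
    show "(\<lambda>t. g k (cis (2 * pi * t))) integrable_on {0..1}" for k
      by (rule circle_continuous_integrable[OF cont])
    show "norm (g k (cis (2 * pi * t))) \<le> 1" for k t
      by (simp add: g_def infdist_nonneg)
    show "(\<lambda>k. g k (cis (2 * pi * t))) \<longlonglongrightarrow> indicator K (cis (2 * pi * t))" for t
      by (rule g_lim)
  qed (simp add: integrable_const_ivl)
  also have "integral {0..1} (\<lambda>t. indicator K (cis (2 * pi * t)) :: real)
      = integral {0..1} (indicator {a..b})"
  \<comment> \<open>the endpoints are excluded, since 0 and 1 give the same point of the circle\<close>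
  proof (rule integral_spike[of "{0, 1}"])
    fix t :: real assume "t \<in> {0..1} - {0, 1}"
    then have "0 < t" "t < 1" by auto
    then have "cis (2 * pi * t) \<in> K \<longleftrightarrow> t \<in> {a..b}"
      using cis_2pi_eq_imp_eq[of t] ab by (force simp: K_def)
    then show "indicator {a..b} t = (indicator K (cis (2 * pi * t)) :: real)"
      by (simp add: indicator_def)
  qed simp
  also have "integral {0..1} (indicator {a..b} :: real \<Rightarrow> real) = b - a"
  proof -
    have "{a..b} \<inter> {0..1} = {a..b}" using ab by auto
    then show ?thesis
      using ab by (simp add: Equivalence_Lebesgue_Henstock_Integration.integral_indicator)
  qed
  finally have "eventually (\<lambda>k. integral {0..1} (\<lambda>t. g k (cis (2 * pi * t))) < y) sequentially"
    using y by (rule order_tendstoD)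
  then obtain k where k: "integral {0..1} (\<lambda>t. g k (cis (2 * pi * t))) < y"
    by (auto simp: eventually_sequentially)
  have "eventually (\<lambda>N. avg (\<lambda>n. g k (cis (2 * pi * x n))) N < y) sequentially"
    by (rule order_tendstoD(2)[OF continuous_equidistributed[OF x cont] k])
  then show ?thesis
  proof eventually_elim
    case (elim N)
    have "indicator {a..b} (frac (x n)) \<le> g k (cis (2 * pi * x n))" for n
    proof (cases "frac (x n) \<in> {a..b}")
      case True
      then have "cis (2 * pi * x n) \<in> K"
        unfolding K_def by (metis cis_2pi_frac imageI)
      then show ?thesis by (simp add: g1 indicator_def)
    qed (simp add: g_def)
    then have "avg (\<lambda>n. indicator {a..b} (frac (x n))) N \<le> avg (\<lambda>n. g k (cis (2 * pi * x n))) N"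
      by (rule avg_mono)
    with elim show ?case by linarith
  qed
qed

text \<open>The upper bound for the arc \<open>{0..c}\<close> bounds the frequency of \<open>{..<c}\<close> from above. The
  one for \<open>{c..1}\<close> bounds the frequency of the complement from above, hence that of \<open>{..<c}\<close>
  from below.\<close>

theorem weyl_criterion:
  assumes x: "\<And>h. h \<noteq> 0 \<Longrightarrow> avg (\<lambda>n. e_char h (x n)) \<longlonglongrightarrow> 0"
    and c: "0 \<le> c" "c \<le> 1"
  shows "avg (\<lambda>n. indicator {..<c} (frac (x n)) :: real) \<longlonglongrightarrow> c"
proof (rule order_tendstoI)
  fix y assume "c < y"
  then have "eventually (\<lambda>N. avg (\<lambda>n. indicator {0..c} (frac (x n))) N < y) sequentially"
    using c by (intro closed_arc_frequency_upper_bound x) auto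
  then show "eventually (\<lambda>N. avg (\<lambda>n. indicator {..<c} (frac (x n))) N < y) sequentially"
  proof eventually_elim
    case (elim N)
    have "avg (\<lambda>n. indicator {..<c} (frac (x n))) N \<le> avg (\<lambda>n. indicator {0..c} (frac (x n)) :: real) N"
      by (intro avg_mono) (auto simp: indicator_def)
    with elim show ?case by linarith
  qed
next
  fix y assume "y < c"
  then have "eventually (\<lambda>N. avg (\<lambda>n. indicator {c..1} (frac (x n))) N < 1 - y) sequentially"
    using c by (intro closed_arc_frequency_upper_bound x) auto
  then show "eventually (\<lambda>N. y < avg (\<lambda>n. indicator {..<c} (frac (x n))) N) sequentially"
    using eventually_ge_at_top[of 1]
  proof eventually_elim
    case (elim N)
    have "indicator {c..1} (frac (x n)) + indicator {..<c} (frac (x n)) = (1::real)" for n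
      using frac_lt_1[of "x n"] by (auto simp: indicator_def)
    then have "avg (\<lambda>n. indicator {c..1} (frac (x n))) N + avg (\<lambda>n. indicator {..<c} (frac (x n))) N = (1::real)"
      using elim avg_const[of N "1::real"] by (simp flip: avg_add)
    with elim show ?case by linarith
  qed
qed

section \<open>Benford sequences and equidistribution of logarithms\<close>

text \<open>Splitting \<open>log b x\<close> into fractional and integer part gives the decomposition of \<open>x\<close>. Conversely
  the logarithm of a mantissa lies in \<open>[0, 1)\<close> and differs from \<open>log b x\<close> by an integer,
  so it is the fractional part.\<close>

lemma mantissa_base_eq:
  assumes b: "b > 1" and x: "x > 0"
  shows "mantissa_base b x = b powr frac (log b x)"
  unfolding mantissa_base_def
proof (rule the_equality)
  have "x = b powr (frac (log b x) + of_int \<lfloor>log b x\<rfloor>)"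
    using b x by (simp add: frac_def)
  also have "\<dots> = b powr frac (log b x) * b powi \<lfloor>log b x\<rfloor>"
    using b by (simp add: powr_add powr_real_of_int')
  finally show "1 \<le> b powr frac (log b x) \<and> b powr frac (log b x) < b \<and>
      (\<exists>k::int. x = b powr frac (log b x) * b powi k)"
    using b powr_less_mono[of "frac (log b x)" 1 b] ge_one_powr_ge_zero[of b "frac (log b x)"]
      frac_lt_1[of "log b x"]
    by auto
next
  fix m assume m: "1 \<le> m \<and> m < b \<and> (\<exists>k::int. x = m * b powi k)"
  then obtain k :: int where k: "x = m * b powi k" by blast
  have "log b x = log b m + of_int k"
    using k b m by (simp add: log_mult powr_real_of_int'[symmetric])
  moreover have "0 \<le> log b m" "log b m < 1"
    using m b by simp_all
  ultimately have "frac (log b x) = log b m"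
    by (simp add: frac_unique_iff)
  then show "m = b powr frac (log b x)"
    using m b by simp
qed

lemma benford_if_exp_means_tendsto_0:
  assumes b: "b > 1" and u: "\<And>n. n \<ge> 1 \<Longrightarrow> u n > 0"
    and mean: "\<And>h. h \<noteq> 0 \<Longrightarrow> avg (\<lambda>n. e_char h (log b (u n))) \<longlonglongrightarrow> 0"
  shows "benford b u"
  unfolding benford_def
proof (intro conjI allI impI)
  fix a assume a: "1 \<le> a \<and> a < b"
  have "indicator {1..<a} (mantissa_base b (u n)) = (indicator {..<log b a} (frac (log b (u n))) :: real)"
    if "n \<ge> 1" for n
  proof -
    have "b powr frac (log b (u n)) \<ge> 1"
      using b by (intro ge_one_powr_ge_zero) auto
    moreover have "b powr frac (log b (u n)) < a \<longleftrightarrow> frac (log b (u n)) < log b a"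
      using a b by (subst less_log_iff) auto
    ultimately show ?thesis
      using b u[OF that] by (simp add: mantissa_base_eq indicator_def)
  qed
  then have "(1 / real N) * (\<Sum>n=1..N. indicator {1..<a} (mantissa_base b (u n)))
      = avg (\<lambda>n. indicator {..<log b a} (frac (log b (u n)))) N" for N
    by (simp add: avg_def)
  moreover have "avg (\<lambda>n. indicator {..<log b a} (frac (log b (u n))) :: real) \<longlonglongrightarrow> log b a"
    using a b by (intro weyl_criterion mean) auto
  ultimately show "(\<lambda>N. (1 / real N) * (\<Sum>n=1..N. indicator {1..<a} (mantissa_base b (u n)))) \<longlonglongrightarrow> log b a"
    by simp
qed (use u in auto)

section \<open>Measurability of the Benford event\<close>

text \<open>The uncountably many conditions on \<open>a\<close> follow from those at rational \<open>a\<close>, because the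
  frequency of \<open>{1..<a}\<close> is monotone in \<open>a\<close> and \<open>log b\<close> is continuous: the value at \<open>a\<close> is
  squeezed between the values at rationals on either side.\<close>

lemma benford_iff_rational:
  assumes b: "b > 1"
  shows "benford b u \<longleftrightarrow> (\<forall>n\<ge>1. u n > 0) \<and>
     (\<forall>a\<in>\<rat>. 1 \<le> a \<and> a < b \<longrightarrow>
        avg (\<lambda>n. indicator {1..<a} (mantissa_base b (u n))) \<longlonglongrightarrow> log b a)"
proof -
  define F where "F a = avg (\<lambda>n. indicator {1..<a} (mantissa_base b (u n)) :: real)" for a
  have mono: "F a N \<le> F a' N" if "a \<le> a'" for a a' N
    unfolding F_def using that by (intro avg_mono) (auto simp: indicator_def)
  have "F a \<longlonglongrightarrow> log b a"
    if lim: "\<And>a. a \<in> \<rat> \<Longrightarrow> 1 \<le> a \<Longrightarrow> a < b \<Longrightarrow> F a \<longlonglongrightarrow> log b a" and a: "1 \<le> a" "a < b" for a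
  proof (cases "a \<in> \<rat>")
    case True
    with lim a show ?thesis by blast
  next
    case False
    \<comment> \<open>1 is rational, so a exceeds 1 and there is room for rationals of \<open>[1, a)\<close> close to a\<close>
    then have a1: "1 < a" using a by (cases "a = 1") auto
    show ?thesis
    proof (rule order_tendstoI)
      fix y assume "y < log b a"
      then have "max 1 (b powr y) < a"
        using a1 b by (simp add: less_log_iff)
      then obtain r where r: "r \<in> \<rat>" "max 1 (b powr y) < r" "r < a"
        using Rats_dense_in_real by blast
      then have "y < log b r" using b by (simp add: less_log_iff)
      then have "eventually (\<lambda>N. y < F r N) sequentially"
        using lim[of r] r a by (intro order_tendstoD) auto
      then show "eventually (\<lambda>N. y < F a N) sequentially"
        by eventually_elim (use mono[of r a] r in \<open>auto intro: less_le_trans\<close>)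
    next
      fix y assume "log b a < y"
      then have "a < min b (b powr y)"
        using a a1 b by (simp add: log_less_iff)
      then obtain r where r: "r \<in> \<rat>" "a < r" "r < min b (b powr y)"
        using Rats_dense_in_real by blast
      then have "log b r < y" using b a1 by (simp add: log_less_iff)
      then have "eventually (\<lambda>N. F r N < y) sequentially"
        using lim[of r] r a by (intro order_tendstoD) auto
      then show "eventually (\<lambda>N. F a N < y) sequentially"
        by eventually_elim (use mono[of a r] r in \<open>auto intro: le_less_trans\<close>)
    qed
  qed
  then show ?thesis
    unfolding benford_def F_def by (auto simp: avg_def[abs_def])
qed

lemma measurable_benford:
  assumes b: "b > 1" and meas: "\<And>n. n \<ge> 1 \<Longrightarrow> Z n \<in> borel_measurable M"
    and pos: "\<And>n \<omega>. n \<ge> 1 \<Longrightarrow> \<omega> \<in> space M \<Longrightarrow> Z n \<omega> > 0"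
  shows "{\<omega> \<in> space M. benford b (\<lambda>n. Z n \<omega>)} \<in> sets M"
proof -
  define F where "F a N \<omega> = avg (\<lambda>n. indicator {1..<a} (b powr frac (log b (Z n \<omega>))) :: real) N"
    for a N \<omega>
  have F: "avg (\<lambda>n. indicator {1..<a} (mantissa_base b (Z n \<omega>))) N = F a N \<omega>"
    if "\<omega> \<in> space M" for a N \<omega>
    using b pos that by (simp add: F_def avg_def mantissa_base_eq)
  have F': "avg (\<lambda>n. indicator {1..<a} (mantissa_base b (Z n \<omega>))) = (\<lambda>N. F a N \<omega>)"
    if "\<omega> \<in> space M" for a \<omega>
    using F[OF that] by blast
  have [measurable]: "F a N \<in> borel_measurable M" for a N
  proof -
    have "(\<lambda>\<omega>. indicator {1..<a} (b powr frac (log b (Z n \<omega>))) :: real) \<in> borel_measurable M"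
      if "n \<in> {1..N}" for n
    proof -
      have [measurable]: "Z n \<in> borel_measurable M" using that meas by simp
      show ?thesis unfolding frac_def by measurable
    qed
    then show ?thesis
      unfolding F_def avg_def by (intro borel_measurable_scaleR borel_measurable_sum) auto
  qed
  have tendsto: "{\<omega> \<in> space M. (\<lambda>N. F a N \<omega>) \<longlonglongrightarrow> l} \<in> sets M" for a l
  proof -
    have "{\<omega> \<in> space M. (\<lambda>N. F a N \<omega>) \<longlonglongrightarrow> l} =
        {\<omega> \<in> space M. \<forall>k. \<exists>N0. \<forall>N\<ge>N0. norm (F a N \<omega> - l) < inverse (real (Suc k))}"
      unfolding LIMSEQ_iff using reals_Archimedean by (force intro: less_trans)
    also have "\<dots> \<in> sets M" by measurable
    finally show ?thesis .
  qed
  have "{\<omega> \<in> space M. benford b (\<lambda>n. Z n \<omega>)} =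
      {\<omega> \<in> space M. \<forall>a\<in>\<rat> \<inter> {1..<b}. (\<lambda>N. F a N \<omega>) \<longlonglongrightarrow> log b a}"
    using pos F' by (auto simp: benford_iff_rational[OF b])
  also have "\<dots> \<in> sets M"
    using tendsto by (intro sets.sets_Collect_countable_All') (auto intro: countable_subset[OF _ countable_rat])
  finally show ?thesis .
qed

section \<open>Almost sure convergence from summable moments\<close>

text \<open>By monotone convergence the expectation of the sum is the sum of the expectations. It is finite,
  so the sum is finite almost everywhere.\<close>

lemma AE_summable_if_summable_integral:
  fixes f :: "nat \<Rightarrow> 'a \<Rightarrow> real"
  assumes int: "\<And>n. integrable M (f n)" and nonneg: "\<And>n x. 0 \<le> f n x"
    and summ: "summable (\<lambda>n. \<integral>x. f n x \<partial>M)"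
  shows "AE x in M. summable (\<lambda>n. f n x)"
proof -
  have [measurable]: "\<And>n. f n \<in> borel_measurable M"
    using int by blast
  have "(\<integral>\<^sup>+x. (\<Sum>n. ennreal (f n x)) \<partial>M) = (\<Sum>n. \<integral>\<^sup>+x. ennreal (f n x) \<partial>M)"
    by (rule nn_integral_suminf) simp
  also have "\<dots> = (\<Sum>n. ennreal (\<integral>x. f n x \<partial>M))"
    using int nonneg by (simp add: nn_integral_eq_integral)
  also have "\<dots> = ennreal (\<Sum>n. \<integral>x. f n x \<partial>M)"
    using nonneg summ by (intro suminf_ennreal2) auto
  finally have "(\<integral>\<^sup>+x. (\<Sum>n. ennreal (f n x)) \<partial>M) \<noteq> \<infinity>" by simp
  then have "AE x in M. (\<Sum>n. ennreal (f n x)) \<noteq> \<infinity>"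
    by (intro nn_integral_PInf_AE) simp_all
  then show ?thesis
    by eventually_elim (use nonneg in \<open>auto intro: summable_suminf_not_top\<close>)
qed

theorem theorem3p2:
  fixes M :: "'a measure" and b :: real and X :: "nat \<Rightarrow> 'a \<Rightarrow> real"
  assumes "prob_space M"
    and "b > 1"
    and "\<And>n. n \<ge> 1 \<Longrightarrow> X n \<in> borel_measurable M"
    and "\<And>n \<omega>. n \<ge> 1 \<Longrightarrow> \<omega> \<in> space M \<Longrightarrow> X n \<omega> > 0"
    and "\<And>h::int. h \<noteq> 0 \<Longrightarrow>
           \<exists>p::real. p \<ge> 1 \<and>
             (\<lambda>N. (\<integral>\<omega>. norm (exp_mean b X h N \<omega>) powr p \<partial>M) / real N) summable_on {1..}"
  shows "almost_surely_benford M b (\<lambda>n \<omega>. \<Prod>k=1..n. X k \<omega>)"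
proof -
  interpret prob_space M by fact
  define Y where "Y n \<omega> = (\<Prod>k=1..n. X k \<omega>)" for n \<omega>
  define S where "S n \<omega> = (\<Sum>k=1..n. log b (X k \<omega>))" for n \<omega>
  have Y_meas: "Y n \<in> borel_measurable M" for n
    unfolding Y_def by (rule borel_measurable_prod) (use assms(3) in auto)
  have S_meas [measurable]: "S n \<in> borel_measurable M" for n
    unfolding S_def by (intro borel_measurable_sum borel_measurable_log assms(3)) auto
  have Y_pos: "Y n \<omega> > 0" if "\<omega> \<in> space M" for n \<omega>
    unfolding Y_def using assms(4) that by (intro prod_pos) auto
  have log_Y: "log b (Y n \<omega>) = S n \<omega>" if "\<omega> \<in> space M" for n \<omega>
  proof -
    have "ln (Y n \<omega>) = (\<Sum>k=1..n. ln (X k \<omega>))"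
      unfolding Y_def using assms(4)[OF _ that] by (intro ln_prod) (auto simp: less_imp_neq[symmetric])
    then show ?thesis by (simp add: S_def log_def sum_divide_distrib)
  qed
  have mean: "exp_mean b X h N \<omega> = avg (\<lambda>n. e_char h (S n \<omega>)) N" for h N \<omega>
    by (simp add: exp_mean_def avg_def S_def scaleR_conv_of_real)
  have "AE \<omega> in M. avg (\<lambda>n. e_char h (S n \<omega>)) \<longlonglongrightarrow> 0" if h: "h \<noteq> 0" for h
  proof -
    obtain p where p: "p \<ge> 1"
      and summ: "(\<lambda>N. (\<integral>\<omega>. norm (exp_mean b X h N \<omega>) powr p \<partial>M) / real N) summable_on {1..}"
      using assms(5)[OF h] by blast
    define f where "f N \<omega> = norm (avg (\<lambda>n. e_char h (S n \<omega>)) N) powr p / real N" for N \<omega>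
    have le1: "norm (avg (\<lambda>n. e_char h (S n \<omega>)) N) \<le> 1" for N \<omega>
      by (rule norm_avg_le) (simp add: e_char_eq_cis)
    have [measurable]: "(\<lambda>\<omega>. avg (\<lambda>n. e_char h (S n \<omega>)) N) \<in> borel_measurable M" for N
      unfolding avg_def e_char_def by measurable
    \<comment> \<open>the integrands are bounded by 1, so their integrals are genuine and not default values\<close>
    have int: "integrable M (f N)" for N
    proof (rule integrable_const_bound[of _ 1])
      have "norm (avg (\<lambda>n. e_char h (S n \<omega>)) N) powr p / real N \<le> 1" for \<omega>
      proof (cases "N = 0")
        case False
        have "norm (avg (\<lambda>n. e_char h (S n \<omega>)) N) powr p \<le> 1"
          using powr_mono2[OF _ _ le1, of p] p by simp
        with False show ?thesis by (simp add: divide_le_eq)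
      qed simp
      then show "AE \<omega> in M. norm (f N \<omega>) \<le> 1" by (simp add: f_def)
      show "f N \<in> borel_measurable M" unfolding f_def by measurable
    qed
    \<comment> \<open>the index 0 may be added to the series: division by \<open>real 0\<close> gives 0\<close>
    have "(\<lambda>N. \<integral>\<omega>. f N \<omega> \<partial>M) summable_on UNIV \<longleftrightarrow>
        (\<lambda>N. (\<integral>\<omega>. norm (exp_mean b X h N \<omega>) powr p \<partial>M) / real N) summable_on {1..}"
      by (rule summable_on_cong_neutral) (auto simp: f_def mean not_less_eq_eq)
    with summ have "summable (\<lambda>N. \<integral>\<omega>. f N \<omega> \<partial>M)"
      by (auto dest: summable_on_imp_summable)
    then have "AE \<omega> in M. summable (\<lambda>N. f N \<omega>)"
      by (rule AE_summable_if_summable_integral[OF int, rotated]) (simp add: f_def)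
    then show ?thesis
    proof eventually_elim
      case (elim \<omega>)
      then show ?case
        unfolding f_def by (rule avg_tendsto_0_if_summable[rotated 2]) (use p in \<open>auto simp: e_char_eq_cis\<close>)
    qed
  qed
  then have "AE \<omega> in M. \<forall>h. h \<noteq> 0 \<longrightarrow> avg (\<lambda>n. e_char h (S n \<omega>)) \<longlonglongrightarrow> 0"
    by (simp add: AE_all_countable)
  then have "AE \<omega> in M. \<omega> \<in> {\<omega> \<in> space M. benford b (\<lambda>n. Y n \<omega>)}"
    using AE_space
  proof eventually_elim
    case (elim \<omega>)
    then have "benford b (\<lambda>n. Y n \<omega>)"
      using assms(2) Y_pos by (intro benford_if_exp_means_tendsto_0) (auto simp: log_Y)
    with elim show ?case by simp
  qed
  moreover have "{\<omega> \<in> space M. benford b (\<lambda>n. Y n \<omega>)} \<in> events"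
    using assms(2) Y_meas Y_pos by (rule measurable_benford)
  ultimately have "prob {\<omega> \<in> space M. benford b (\<lambda>n. Y n \<omega>)} = 1"
    by (simp only: AE_in_set_eq_1)
  then show ?thesis by (simp add: almost_surely_benford_def Y_def)
qed

end
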